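(* Let $P$ be the Petersen graph. Then $\dim\operatorname{NCV}(P)=4=|\operatorname{SpecC}(P)|$.
   Context: A signed graph with underlying finite simple graph $\Gamma=(V,E)$ is a pair $(\Gamma,\sigma)$ with $\sigma:E\to\{+,-\}$. The sign of a cycle is the product of the signs of its edges; a cycle is negative if its sign is $-$. The cycle spectrum $\operatorname{SpecC}(\Gamma)$ is the set of lengths of cycles (simple closed paths, as subgraphs) of $\Gamma$. For a signature $\sigma$ let $c_l^-(\sigma)$ be the number of negative cycles of length $l$; the negative cycle vector is $c^-(\sigma)=(c_l^-(\sigma))_{l\in\operatorname{SpecC}(\Gamma)}\in\mathbb{R}^{\operatorname{SpecC}(\Gamma)}$. $\operatorname{NCV}(\Gamma)$ is the set of vectors $c^-(\sigma)$ over all signatures $\sigma$ of $\Gamma$, and $\dim\operatorname{NCV}(\Gamma)$ is the dimension of its linear span. *)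

theory Defs
  imports "HOL-Analysis.Analysis" "HOL-Analysis.Finite_Function_Topology"
begin

type_synonym 'a graph = "'a set \<times> 'a set set"

abbreviation verts :: "'a graph \<Rightarrow> 'a set" where "verts \<equiv> fst"
abbreviation edges :: "'a graph \<Rightarrow> 'a set set" where "edges \<equiv> snd"

definition finite_simple_graph :: "'a graph \<Rightarrow> bool" where
  "finite_simple_graph G \<longleftrightarrow>
     finite (verts G) \<and> (\<forall>e\<in>edges G. e \<subseteq> verts G \<and> card e = 2)"

definition closed_path_edges :: "'a list \<Rightarrow> 'a set set" where
  "closed_path_edges vs = {{vs ! i, vs ! (Suc i mod length vs)} | i. i < length vs}"

text \<open>A cycle is a subgraph, not a walk. It is represented by its edge set, which
  determines it, so that different starting points and directions of traversal give
  the same cycle. Its length is its number of edges.\<close>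

definition cycles :: "'a graph \<Rightarrow> 'a set set set" where
  "cycles G = {closed_path_edges vs | vs.
     3 \<le> length vs \<and> distinct vs \<and> set vs \<subseteq> verts G \<and> closed_path_edges vs \<subseteq> edges G}"

definition SpecC :: "'a graph \<Rightarrow> nat set" where
  "SpecC G = card ` cycles G"

text \<open>The signs are the integers \<open>1\<close> and \<open>-1\<close>. The values of a signature outside the
  edge set are irrelevant.\<close>

definition signatures :: "'a graph \<Rightarrow> ('a set \<Rightarrow> int) set" where
  "signatures G = edges G \<rightarrow> {1, -1}"

definition cycle_sign :: "('a set \<Rightarrow> int) \<Rightarrow> 'a set set \<Rightarrow> int" where
  "cycle_sign \<sigma> C = (\<Prod>e\<in>C. \<sigma> e)"

definition num_neg_cycles :: "'a graph \<Rightarrow> ('a set \<Rightarrow> int) \<Rightarrow> nat \<Rightarrow> nat" where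
  "num_neg_cycles G \<sigma> l = card {C \<in> cycles G. card C = l \<and> cycle_sign \<sigma> C = -1}"

text \<open>For a finite graph, the real vectors indexed by the finite set \<^term>\<open>SpecC G\<close> are
  regarded as the finitely supported functions on \<^typ>\<open>nat\<close> that vanish outside
  \<^term>\<open>SpecC G\<close>. These form a real vector space with the coordinatewise operations.\<close>

definition neg_cycle_vector :: "'a graph \<Rightarrow> ('a set \<Rightarrow> int) \<Rightarrow> nat \<Rightarrow>\<^sub>0 real" where
  "neg_cycle_vector G \<sigma> = (\<Sum>l\<in>SpecC G. Poly_Mapping.single l (real (num_neg_cycles G \<sigma> l)))"

definition NCV :: "'a graph \<Rightarrow> (nat \<Rightarrow>\<^sub>0 real) set" where
  "NCV G = neg_cycle_vector G ` signatures G"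

text \<open>The usual drawing: outer pentagon \<open>0,\<dots>,4\<close>, inner pentagram \<open>5,\<dots>,9\<close>, five spokes.\<close>

definition petersen :: "nat graph" where
  "petersen = ({..<10},
     (\<Union>i<5. {{i, (i + 1) mod 5}, {i, i + 5}, {i + 5, (i + 2) mod 5 + 5}}))"

lemma finite_cycles:
  assumes "finite_simple_graph G"
  shows "finite (cycles G)"
proof -
  have "edges G \<subseteq> Pow (verts G)"
    using assms by (auto simp: finite_simple_graph_def)
  then have "finite (edges G)"
    using assms by (meson finite_Pow_iff finite_simple_graph_def finite_subset)
  moreover have "cycles G \<subseteq> Pow (edges G)"
    by (auto simp: cycles_def)
  ultimately show ?thesis
    by (meson finite_Pow_iff finite_subset)
qed

lemma lookup_neg_cycle_vector:
  assumes "finite_simple_graph G"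
  shows "Poly_Mapping.lookup (neg_cycle_vector G \<sigma>) l =
    (if l \<in> SpecC G then real (num_neg_cycles G \<sigma> l) else 0)"
proof -
  have "finite (SpecC G)"
    using finite_cycles[OF assms] by (simp add: SpecC_def)
  then show ?thesis
    by (simp add: neg_cycle_vector_def lookup_sum lookup_single when_def)
qed

lemma finite_simple_graph_petersen: "finite_simple_graph petersen"
  by (auto simp: finite_simple_graph_def petersen_def lessThan_nat_numeral lessThan_Suc
      doubleton_eq_iff card_insert_if)

end

theory Submission
  imports Defs
begin

text \<open>The dimension formula holds for every finite simple graph \<open>G\<close>: the dimension equals
  \<open>|SpecC G|\<close>. Regard the sign \<open>\<chi>\<^sub>C \<sigma>\<close> of a cycle \<open>C\<close> as a function of the
  signature \<open>\<sigma>\<close>. The signatures form the group \<open>{1, -1}\<^sup>E\<close>, and the functions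
  \<open>\<chi>\<^sub>C\<close> are pairwise distinct nontrivial characters of it, hence orthogonal to each other
  and to the constant \<open>1\<close> (lemma \<open>sum_cycle_sign_mult\<close>). A negative cycle \<open>C\<close> is
  counted by \<open>(1 - \<chi>\<^sub>C) / 2\<close>, so weighting the negative cycle vectors with
  \<open>\<chi>\<^sub>D\<close> and summing over all signatures annihilates the contribution of every cycle except
  \<open>D\<close>; a nonzero multiple of the unit vector at the length of \<open>D\<close> remains (lemma
  \<open>sum_sign_neg_cycle_vector\<close>). Every unit vector thus lies in the span.

  It remains to show that the cycle lengths of the Petersen graph are 5, 6, 8 and 9. Cycles of these
  lengths are exhibited. The lengths 3, 4, 7 and 10 are excluded using only that the graph is
  cubic, has ten vertices, and contains neither triangles nor 4-cycles. In such a graph a chord joins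
  vertices at distance at least 4 along a cycle. Hence a 7-cycle has no chord, and the edges leaving
  it would have to reach the three remaining vertices in a periodic pattern of period 3, which does
  not close up modulo 7. On a 10-cycle the third edge at every vertex is a chord spanning 4 or 5
  steps, and each way to place these chords produces a triangle or a 4-cycle.\<close>

section \<open>The dimension of the negative cycle vectors of an arbitrary graph\<close>

text \<open>A signature is determined on the graph by its restriction to the edge set; fixing the values
  elsewhere gives a finite set of representatives, over which one can sum.\<close>

definition restricted_signatures :: "'a graph \<Rightarrow> ('a set \<Rightarrow> int) set" where
  "restricted_signatures G = (edges G \<rightarrow>\<^sub>E {1, -1})"

text \<open>Orthogonality of characters. The sum of products over all signatures factors over the edges,
  and an edge in exactly one of the two sets contributes the factor \<open>1 + (-1) = 0\<close>. The case
  \<open>D = {}\<close> says that a nontrivial character sums to zero.\<close>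

lemma sum_cycle_sign_mult:
  assumes "finite (edges G)" and C: "C \<subseteq> edges G" and D: "D \<subseteq> edges G"
  shows "(\<Sum>\<sigma>\<in>restricted_signatures G. cycle_sign \<sigma> C * cycle_sign \<sigma> D) =
    (if C = D then 2 ^ card (edges G) else 0)"
proof -
  define h :: "'a set \<Rightarrow> int \<Rightarrow> int"
    where "h e s = (if e \<in> C then s else 1) * (if e \<in> D then s else 1)" for e s
  have sign: "cycle_sign \<sigma> A = (\<Prod>e\<in>edges G. if e \<in> A then \<sigma> e else 1)"
    if "A \<subseteq> edges G" for \<sigma> A
    unfolding cycle_sign_def using that assms(1)
    by (simp add: prod.If_cases Int_absorb1)
  have "(\<Sum>\<sigma>\<in>restricted_signatures G. cycle_sign \<sigma> C * cycle_sign \<sigma> D) =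
      (\<Sum>\<sigma>\<in>restricted_signatures G. \<Prod>e\<in>edges G. h e (\<sigma> e))"
    by (simp add: sign[OF C] sign[OF D] h_def prod.distrib)
  also have "\<dots> = (\<Prod>e\<in>edges G. \<Sum>s\<in>{1, -1}. h e s)"
    unfolding restricted_signatures_def
    by (rule prod_sum_PiE[symmetric]) (use assms in auto)
  also have "\<dots> = (\<Prod>e\<in>edges G. if e \<in> C \<longleftrightarrow> e \<in> D then 2 else 0)"
    by (rule prod.cong) (auto simp: h_def)
  also have "\<dots> = (if C = D then 2 ^ card (edges G) else 0)"
  proof (cases "C = D")
    case False
    then obtain e where "e \<in> edges G" "(e \<in> C) \<noteq> (e \<in> D)"
      using C D by blast
    then show ?thesis
      using assms(1) False by (auto simp: prod_zero_iff)
  qed simp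
  finally show ?thesis .
qed

lemma lookup_scaleR: "Poly_Mapping.lookup (r *\<^sub>R p) k = r *\<^sub>R Poly_Mapping.lookup p k"
proof -
  have "finite {i. r *\<^sub>R Poly_Mapping.lookup p i \<noteq> 0}"
    by (rule finite_subset[OF _ finite_lookup[of p]]) auto
  then show ?thesis
    by (simp add: scaleR_poly_mapping_def)
qed

lemma finite_edges: "finite_simple_graph G \<Longrightarrow> finite (edges G)"
  by (metis (no_types, lifting) Pow_iff finite_Pow_iff finite_simple_graph_def finite_subset subsetI)

lemma cycles_subset_edges: "C \<in> cycles G \<Longrightarrow> C \<subseteq> edges G"
  by (auto simp: cycles_def)

lemma cycle_nonempty: "C \<in> cycles G \<Longrightarrow> C \<noteq> {}"
  by (force simp: cycles_def closed_path_edges_def)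

lemma cycle_sign_cases:
  assumes "\<sigma> \<in> signatures G" "C \<subseteq> edges G"
  shows "cycle_sign \<sigma> C = 1 \<or> cycle_sign \<sigma> C = -1"
proof -
  have "\<forall>e\<in>C. \<sigma> e = 1 \<or> \<sigma> e = -1"
    using assms by (auto simp: signatures_def)
  then show ?thesis
    unfolding cycle_sign_def by (induction C rule: infinite_finite_induct) auto
qed

lemma real_num_neg_cycles:
  assumes "finite_simple_graph G" "\<sigma> \<in> signatures G"
  shows "real (num_neg_cycles G \<sigma> l) =
    (\<Sum>C | C \<in> cycles G \<and> card C = l. (1 - real_of_int (cycle_sign \<sigma> C)) / 2)"
proof -
  let ?A = "{C \<in> cycles G. card C = l}"
  have fin: "finite ?A"
    using finite_cycles[OF assms(1)] by simp
  have "(\<Sum>C\<in>?A. (1 - real_of_int (cycle_sign \<sigma> C)) / 2) =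
      (\<Sum>C\<in>?A. if cycle_sign \<sigma> C = -1 then 1 else 0)"
  proof (rule sum.cong)
    fix C assume "C \<in> ?A"
    then have "cycle_sign \<sigma> C = 1 \<or> cycle_sign \<sigma> C = -1"
      using cycle_sign_cases[OF assms(2)] cycles_subset_edges by blast
    then show "(1 - real_of_int (cycle_sign \<sigma> C)) / 2 = (if cycle_sign \<sigma> C = -1 then 1 else 0)"
      by auto
  qed simp
  also have "\<dots> = real (num_neg_cycles G \<sigma> l)"
    using fin by (simp add: num_neg_cycles_def sum.If_cases Int_def conj_assoc)
  finally show ?thesis ..
qed

text \<open>Expanding each count of negative cycles as a sum of \<open>(1 - \<chi>\<^sub>C) / 2\<close>,
  orthogonality to \<open>\<chi>\<^sub>D\<close> leaves only the term \<open>C = D\<close>.\<close>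

lemma sum_sign_neg_cycle_vector:
  assumes G: "finite_simple_graph G" and D: "D \<in> cycles G"
  shows "(\<Sum>\<sigma>\<in>restricted_signatures G. real_of_int (cycle_sign \<sigma> D) *\<^sub>R neg_cycle_vector G \<sigma>) =
    (- (2 ^ card (edges G)) / 2) *\<^sub>R Poly_Mapping.single (card D) 1"
    (is "?L = ?R")
proof (rule poly_mapping_eqI)
  fix l
  let ?S = "restricted_signatures G" and ?A = "{C \<in> cycles G. card C = l}"
  note fin = finite_edges[OF G] and DE = cycles_subset_edges[OF D]
  have finA: "finite ?A"
    using finite_cycles[OF G] by simp
  have sum_one: "(\<Sum>\<sigma>\<in>?S. real_of_int (cycle_sign \<sigma> D)) = 0"
    using sum_cycle_sign_mult[OF fin DE, of "{}"] cycle_nonempty[OF D]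
    by (simp add: cycle_sign_def flip: of_int_sum of_int_prod)
  have sum_two: "(\<Sum>\<sigma>\<in>?S. real_of_int (cycle_sign \<sigma> D) * real_of_int (cycle_sign \<sigma> C)) =
      (if C = D then 2 ^ card (edges G) else 0)" if "C \<in> cycles G" for C
    using sum_cycle_sign_mult[OF fin DE cycles_subset_edges[OF that]]
    by (auto simp flip: of_int_mult of_int_sum)
  have "Poly_Mapping.lookup ?L l =
      (\<Sum>\<sigma>\<in>?S. real_of_int (cycle_sign \<sigma> D) * real (num_neg_cycles G \<sigma> l))"
    if "l \<in> SpecC G"
    using that by (simp add: lookup_sum lookup_scaleR lookup_neg_cycle_vector[OF G])
  moreover have "num_neg_cycles G \<sigma> l = 0" if "l \<notin> SpecC G" for \<sigma>
  proof -
    have "{C \<in> cycles G. card C = l \<and> cycle_sign \<sigma> C = -1} = {}"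
      using that by (auto simp: SpecC_def)
    then show ?thesis
      unfolding num_neg_cycles_def by (metis card.empty)
  qed
  ultimately have "Poly_Mapping.lookup ?L l =
      (\<Sum>\<sigma>\<in>?S. real_of_int (cycle_sign \<sigma> D) * real (num_neg_cycles G \<sigma> l))"
    by (cases "l \<in> SpecC G") (simp_all add: lookup_sum lookup_scaleR lookup_neg_cycle_vector[OF G])
  also have "\<dots> = (\<Sum>\<sigma>\<in>?S. \<Sum>C\<in>?A.
      (real_of_int (cycle_sign \<sigma> D) - real_of_int (cycle_sign \<sigma> D) * real_of_int (cycle_sign \<sigma> C)) / 2)"
  proof (rule sum.cong)
    fix \<sigma> assume "\<sigma> \<in> ?S"
    then have "\<sigma> \<in> signatures G"
      by (auto simp: restricted_signatures_def signatures_def)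
    then show "real_of_int (cycle_sign \<sigma> D) * real (num_neg_cycles G \<sigma> l) = (\<Sum>C\<in>?A.
      (real_of_int (cycle_sign \<sigma> D) - real_of_int (cycle_sign \<sigma> D) * real_of_int (cycle_sign \<sigma> C)) / 2)"
      by (simp add: real_num_neg_cycles[OF G] sum_distrib_left algebra_simps)
  qed simp
  also have "\<dots> = (\<Sum>C\<in>?A. ((\<Sum>\<sigma>\<in>?S. real_of_int (cycle_sign \<sigma> D)) -
      (\<Sum>\<sigma>\<in>?S. real_of_int (cycle_sign \<sigma> D) * real_of_int (cycle_sign \<sigma> C))) / 2)"
    by (subst sum.swap) (simp add: sum_subtractf flip: sum_divide_distrib)
  also have "\<dots> = (\<Sum>C\<in>?A. if C = D then - (2 ^ card (edges G)) / 2 else 0)"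
    by (rule sum.cong) (auto simp: sum_one sum_two)
  also have "\<dots> = Poly_Mapping.lookup ?R l"
    using D finA by (auto simp: lookup_scaleR lookup_single when_def)
  finally show "Poly_Mapping.lookup ?L l = Poly_Mapping.lookup ?R l" .
qed

lemma span_NCV:
  assumes G: "finite_simple_graph G"
  shows "span (NCV G) = span ((\<lambda>l. Poly_Mapping.single l 1) ` SpecC G)"
    (is "_ = span ?B")
proof (rule span_eq[THEN iffD2, OF conjI])
  show "NCV G \<subseteq> span ?B"
  proof
    fix x assume "x \<in> NCV G"
    then obtain \<sigma> where x: "x = neg_cycle_vector G \<sigma>"
      by (auto simp: NCV_def)
    have "Poly_Mapping.single l r \<in> span ?B" if "l \<in> SpecC G" for l and r :: real
    proof -
      have "Poly_Mapping.single l r = r *\<^sub>R Poly_Mapping.single l 1"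
        by (rule poly_mapping_eqI) (simp add: lookup_scaleR lookup_single when_def)
      then show ?thesis
        using that by (auto intro: span_scale span_base)
    qed
    then show "x \<in> span ?B"
      unfolding x neg_cycle_vector_def by (intro span_sum) auto
  qed
next
  show "?B \<subseteq> span (NCV G)"
  proof
    fix x assume "x \<in> ?B"
    then obtain D where D: "D \<in> cycles G" and x: "x = Poly_Mapping.single (card D) 1"
      by (auto simp: SpecC_def)
    define c :: real where "c = - (2 ^ card (edges G)) / 2"
    have "c *\<^sub>R x \<in> span (NCV G)"
      unfolding x c_def sum_sign_neg_cycle_vector[OF G D, symmetric]
      by (intro span_sum span_scale span_base)
        (auto simp: NCV_def restricted_signatures_def signatures_def)
    then have "inverse c *\<^sub>R (c *\<^sub>R x) \<in> span (NCV G)"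
      by (rule span_scale)
    then show "x \<in> span (NCV G)"
      by (simp add: c_def)
  qed
qed

lemma inj_single_one: "inj (\<lambda>l. Poly_Mapping.single l (1::real))"
  by (rule injI) (metis lookup_single_eq lookup_single_not_eq zero_neq_one)

lemma independent_single:
  assumes "finite L"
  shows "independent ((\<lambda>l. Poly_Mapping.single l (1::real)) ` L)"
proof -
  let ?e = "\<lambda>l. Poly_Mapping.single l (1::real)"
  have "u (?e l) = 0" if "l \<in> L" and "(\<Sum>v\<in>?e ` L. u v *\<^sub>R v) = 0" for u l
  proof -
    have "0 = Poly_Mapping.lookup (\<Sum>v\<in>?e ` L. u v *\<^sub>R v) l"
      using that by simp
    also have "\<dots> = (\<Sum>k\<in>L. u (?e k) * (if k = l then 1 else 0))"
      by (subst sum.reindex) (auto intro: inj_on_subset[OF inj_single_one] simp: lookup_sum lookup_scaleR lookup_single when_def)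
    also have "\<dots> = u (?e l)"
      using \<open>l \<in> L\<close> assms by (simp add: if_distrib cong: if_cong)
    finally show ?thesis by simp
  qed
  then show ?thesis
    using assms by (intro independent_if_scalars_zero) auto
qed

theorem dim_span_NCV:
  assumes G: "finite_simple_graph G"
  shows "dim (span (NCV G)) = card (SpecC G)"
proof -
  let ?e = "\<lambda>l. Poly_Mapping.single l (1::real)"
  have fin: "finite (SpecC G)"
    using finite_cycles[OF G] by (simp add: SpecC_def)
  have "dim (span (NCV G)) = card (?e ` SpecC G)"
    unfolding span_NCV[OF G] dim_span
    by (rule dim_eq_card_independent[OF independent_single[OF fin]])
  then show ?thesis
    by (simp add: card_image inj_on_subset[OF inj_single_one])
qed

section \<open>Cycle lengths in cubic graphs of girth at least five on ten vertices\<close>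

text \<open>Two positions on the closed path can give the same edge only if each is the successor of the
  other, which is impossible for length at least 3; for length 2 both positions do give the same edge.\<close>

lemma card_closed_path_edges:
  assumes "3 \<le> length vs" "distinct vs"
  shows "card (closed_path_edges vs) = length vs"
proof -
  let ?n = "length vs"
  have "inj_on (\<lambda>i. {vs ! i, vs ! (Suc i mod ?n)}) {..<?n}"
  proof (rule inj_onI)
    fix i j
    assume ij: "i \<in> {..<?n}" "j \<in> {..<?n}"
      and eq: "{vs ! i, vs ! (Suc i mod ?n)} = {vs ! j, vs ! (Suc j mod ?n)}"
    have pos: "Suc i mod ?n < ?n" "Suc j mod ?n < ?n"
      using assms by (auto intro!: mod_less_divisor)
    have "i = j \<or> (i = Suc j mod ?n \<and> Suc i mod ?n = j)"
      using eq ij pos assms(2) by (auto simp: doubleton_eq_iff nth_eq_iff_index_eq)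
    then show "i = j"
      using ij assms(1) by (auto simp: mod_Suc split: if_splits)
  qed
  moreover have "closed_path_edges vs = (\<lambda>i. {vs ! i, vs ! (Suc i mod ?n)}) ` {..<?n}"
    by (auto simp: closed_path_edges_def)
  ultimately show ?thesis
    by (simp add: card_image)
qed

locale cubic_girth_five =
  fixes V :: "'a set" and adj :: "'a \<Rightarrow> 'a \<Rightarrow> bool"
  assumes card_V: "card V = 10"
    and adj_sym: "adj u v \<Longrightarrow> adj v u"
    and adj_in: "adj u v \<Longrightarrow> v \<in> V"
    and cubic: "v \<in> V \<Longrightarrow> card {u. adj v u} = 3"
    and no_triangle: "adj a b \<Longrightarrow> adj b c \<Longrightarrow> adj c a \<Longrightarrow> False"
    and no_square: "adj a b \<Longrightarrow> adj b c \<Longrightarrow> adj c d \<Longrightarrow> adj d a \<Longrightarrow> a = c \<or> b = d"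
begin

text \<open>A cycle of length \<open>n\<close> is traversed by a function of period \<open>n\<close>, so that indices may be
  shifted freely and every position can serve as the starting point.\<close>

definition cyclic :: "nat \<Rightarrow> (nat \<Rightarrow> 'a) \<Rightarrow> bool" where
  "cyclic n f \<longleftrightarrow> (\<forall>i j. f i = f j \<longleftrightarrow> i mod n = j mod n) \<and> (\<forall>i. adj (f i) (f (Suc i)))"

lemma third_neighbour:
  assumes "v \<in> V"
  obtains w where "adj v w" "w \<noteq> a" "w \<noteq> b"
proof -
  have "\<not> {u. adj v u} \<subseteq> {a, b}"
  proof
    assume "{u. adj v u} \<subseteq> {a, b}"
    then have "card {u. adj v u} \<le> card {a, b}"
      by (intro card_mono) auto
    also have "\<dots> \<le> 2"
      by (simp add: card_insert_if)
    finally show False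
      using cubic[OF assms] by simp
  qed
  then show thesis
    using that by blast
qed

lemma cyclic_in: "cyclic n f \<Longrightarrow> f i \<in> V"
  by (meson adj_in adj_sym cyclic_def)

lemma cyclic_eq_iff:
  assumes "cyclic n f"
  shows "f (i + k) = f i \<longleftrightarrow> n dvd k"
  using assms mod_eq_dvd_iff_nat[of i "i + k" n] by (simp add: cyclic_def)

lemma no_cyclic_3: "\<not> cyclic 3 f"
proof
  assume f: "cyclic 3 f"
  then have step: "adj (f i) (f (Suc i))" for i
    by (simp add: cyclic_def)
  have "f 3 = f 0"
    using cyclic_eq_iff[OF f, of 0 3] by simp
  moreover have "adj (f 0) (f 1)" "adj (f 1) (f 2)" "adj (f 2) (f 3)"
    using step[of 0] step[of 1] step[of 2] by (simp_all add: numeral_eq_Suc)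
  ultimately show False using no_triangle by metis
qed

lemma no_cyclic_4: "\<not> cyclic 4 f"
proof
  assume f: "cyclic 4 f"
  then have step: "adj (f i) (f (Suc i))" for i
    by (simp add: cyclic_def)
  have "f 4 = f 0" "f 2 \<noteq> f 0" "f 3 \<noteq> f 1"
    using f by (simp_all add: cyclic_def)
  moreover have "adj (f 0) (f 1)" "adj (f 1) (f 2)" "adj (f 2) (f 3)" "adj (f 3) (f 4)"
    using step[of 0] step[of 1] step[of 2] step[of 3] by (simp_all add: numeral_eq_Suc)
  ultimately show False using no_square by metis
qed

text \<open>A chord spanning 2 or 3 steps would close up to a triangle or a 4-cycle.\<close>

lemma cyclic_chord:
  assumes f: "cyclic n f" and "adj (f i) (f (i + k))" and "4 \<le> n"
  shows "k mod n \<noteq> 0" "k \<noteq> 2" "k \<noteq> 3"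
proof -
  have step: "adj (f j) (f (Suc j))" for j
    using f by (simp add: cyclic_def)
  have step2: "f j \<noteq> f (Suc (Suc j))" for j
    using cyclic_eq_iff[OF f, of j 2] assms(3) by (auto dest: dvd_imp_le)
  show "k mod n \<noteq> 0"
  proof
    assume "k mod n = 0"
    then have "f (i + k) = f i"
      using f by (auto simp: cyclic_def)
    then show False
      using assms(2) no_triangle by metis
  qed
  show "k \<noteq> 2"
    using assms(2) step[of i] step[of "Suc i"] no_triangle adj_sym
    by (metis add_2_eq_Suc')
  show "k \<noteq> 3"
    using assms(2) step[of i] step[of "Suc i"] step[of "Suc (Suc i)"] step2[of i] step2[of "Suc i"]
      no_square adj_sym
    by (metis add_Suc_right add_2_eq_Suc' numeral_3_eq_3 numeral_2_eq_2)
qed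

text \<open>The same exclusion for the complementary arc of the cycle, which the chord spans in the other
  direction.\<close>

lemma cyclic_chord_back:
  assumes f: "cyclic n f" and a: "adj (f i) (f (i + k))" and k: "k \<le> n" and n: "4 \<le> n"
  shows "k + 2 \<noteq> n" "k + 3 \<noteq> n"
proof -
  have "adj (f (i + k)) (f (i + k + (n - k)))"
    using adj_sym[OF a] cyclic_eq_iff[OF f, of i n] k by simp
  from cyclic_chord[OF f this n] show "k + 2 \<noteq> n" "k + 3 \<noteq> n"
    by auto
qed

text \<open>The neighbour of a vertex \<open>f i\<close> that is not one of the two adjacent to it on the cycle is
  either outside the cycle or at least four steps away in both directions.\<close>

lemma third_neighbour_off_arc:
  assumes f: "cyclic n f" and n: "4 \<le> n"
  obtains w where "adj (f i) w" "\<And>k. w = f (i + k) \<Longrightarrow> 4 \<le> k mod n \<and> k mod n + 4 \<le> n"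
proof -
  obtain w where w: "adj (f i) w" "w \<noteq> f (Suc i)" "w \<noteq> f (i + (n - 1))"
    using third_neighbour[OF cyclic_in[OF f]] by blast
  have "4 \<le> k mod n \<and> k mod n + 4 \<le> n" if "w = f (i + k)" for k
  proof -
    define m where "m = k mod n"
    have m: "m < n"
      using n by (simp add: m_def)
    have eq: "w = f (i + m)"
      using that f by (simp add: cyclic_def m_def mod_add_right_eq)
    have "m \<noteq> 0" "m \<noteq> 2" "m \<noteq> 3"
      using cyclic_chord[OF f _ n, of i m] w(1) eq m by auto
    moreover have "m + 2 \<noteq> n" "m + 3 \<noteq> n"
      using cyclic_chord_back[OF f _ _ n, of i m] w(1) eq m by auto
    moreover have "m \<noteq> 1" "m + 1 \<noteq> n"
      using w(2,3) eq by auto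
    ultimately show ?thesis
      using m unfolding m_def[symmetric] by linarith
  qed
  then show thesis
    using that w(1) by blast
qed

lemma cyclic_image:
  assumes "cyclic n f" "0 < n"
  shows "range f = f ` {..<n}" "card (range f) = n"
proof -
  have "f i \<in> f ` {..<n}" for i
  proof
    show "f i = f (i mod n)" "i mod n \<in> {..<n}"
      using assms by (simp_all add: cyclic_def)
  qed
  then show eq: "range f = f ` {..<n}"
    by auto
  have "inj_on f {..<n}"
    using assms by (auto simp: inj_on_def cyclic_def)
  then show "card (range f) = n"
    unfolding eq by (simp add: card_image)
qed

text \<open>No vertex of a 7-cycle is at least four steps away in both directions, so the third neighbour
  \<open>w i\<close> of each \<open>f i\<close> is one of the three vertices outside. Since the girth is at least
  five, \<open>w i\<close>, \<open>w (i + 1)\<close>, \<open>w (i + 2)\<close> are distinct for all \<open>i\<close>, which forces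
  \<open>w (i + 3) = w i\<close>. Then \<open>w 6 = w 3 = w 0\<close>, a triangle with the edge from \<open>f 6\<close> to
  \<open>f 7 = f 0\<close>.\<close>

lemma no_cyclic_7: "\<not> cyclic 7 f"
proof
  assume f: "cyclic 7 f"
  have "\<exists>w. adj (f i) w \<and> w \<notin> range f" for i
  proof -
    obtain w where w: "adj (f i) w" "\<And>k. w = f (i + k) \<Longrightarrow> 4 \<le> k mod 7 \<and> k mod 7 + 4 \<le> 7"
      using third_neighbour_off_arc[OF f, of i] by auto
    have "w \<noteq> f j" for j
    proof
      assume "w = f j"
      \<comment> \<open>\<open>7 * i + j\<close> is congruent to \<open>j\<close> and is of the form \<open>i + k\<close> without a
        truncated subtraction.\<close>
      also have "f j = f (i + (j + 6 * i))"
        using f by (simp add: cyclic_def)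
      finally show False
        using w(2)[of "j + 6 * i"] by linarith
    qed
    then show ?thesis
      using w(1) by blast
  qed
  then obtain w where adj: "\<And>i. adj (f i) (w i)" and out: "\<And>i. w i \<notin> range f"
    by metis
  have step: "adj (f i) (f (Suc i))" for i
    using f by (simp add: cyclic_def)
  have w1: "w i \<noteq> w (Suc i)" for i
    using adj[of i] adj[of "Suc i"] step[of i] no_triangle adj_sym by metis
  have w2: "w i \<noteq> w (Suc (Suc i))" for i
  proof
    assume "w i = w (Suc (Suc i))"
    then have "f i = f (Suc (Suc i)) \<or> f (Suc i) = w i"
      using adj[of i] adj[of "Suc (Suc i)"] step[of i] step[of "Suc i"] no_square adj_sym by metis
    moreover have "f i \<noteq> f (Suc (Suc i))"
      using cyclic_eq_iff[OF f, of i 2] by (simp add: eq_commute)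
    ultimately show False
      using out[of i] by (metis rangeI)
  qed
  have fin: "finite V"
    using card_V by (metis card.infinite zero_neq_numeral)
  have three: "card (V - range f) = 3"
    using fin card_V cyclic_image(2)[OF f] cyclic_in[OF f]
    by (subst card_Diff_subset) (auto intro: finite_subset)
  have "w i = w (i + 3)" for i
  proof (rule ccontr)
    assume "w i \<noteq> w (i + 3)"
    then have "card {w i, w (i + 1), w (i + 2), w (i + 3)} = 4"
      using w1[of i] w1[of "i + 1"] w1[of "i + 2"] w2[of i] w2[of "i + 1"]
      by (simp add: card_insert_if numeral_eq_Suc)
    moreover have "{w i, w (i + 1), w (i + 2), w (i + 3)} \<subseteq> V - range f"
      using out adj_in[OF adj] by auto
    then have "card {w i, w (i + 1), w (i + 2), w (i + 3)} \<le> 3"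
      using card_mono fin three by (metis finite_Diff)
    ultimately show False by simp
  qed
  from this[of 0] this[of 3] have "w 6 = w 0"
    by simp
  moreover have "adj (f 6) (f 0)"
    using step[of 6] cyclic_eq_iff[OF f, of 0 7] by simp
  ultimately show False
    using adj[of 0] adj[of 6] no_triangle adj_sym by metis
qed

text \<open>All vertices lie on a 10-cycle, so the third edge at \<open>f i\<close> is a chord to \<open>f (i + 4)\<close>,
  \<open>f (i + 5)\<close> or \<open>f (i + 6)\<close>. If it goes to \<open>f (i + 4)\<close>, each possible chord at
  \<open>f (i + 5)\<close> closes a triangle or a 4-cycle; the case \<open>f (i + 6)\<close> is the same chord seen
  from its other end. If all chords join opposite vertices, then \<open>f 0\<close>, \<open>f 1\<close>, \<open>f 6\<close>,
  \<open>f 5\<close> form a 4-cycle.\<close>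

lemma no_cyclic_10: "\<not> cyclic 10 f"
proof
  assume f: "cyclic 10 f"
  have fin: "finite V"
    using card_V by (metis card.infinite zero_neq_numeral)
  have range: "range f = V"
    by (rule card_subset_eq[OF fin]) (use cyclic_in[OF f] cyclic_image(2)[OF f] card_V in auto)
  have step: "adj (f i) (f (i + 1))" for i
    using f by (simp add: cyclic_def)
  have per: "f (i + 10) = f i" for i
    using f by (simp add: cyclic_def)
  have ne: "f (i + k) \<noteq> f i" if "\<not> 10 dvd k" for i k
    using that cyclic_eq_iff[OF f] by blast
  have chord: "adj (f i) (f (i + 4)) \<or> adj (f i) (f (i + 5)) \<or> adj (f i) (f (i + 6))" for i
  proof -
    obtain w where w: "adj (f i) w" "\<And>k. w = f (i + k) \<Longrightarrow> 4 \<le> k mod 10 \<and> k mod 10 + 4 \<le> 10"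
      using third_neighbour_off_arc[OF f, of i] by auto
    then obtain j where j: "w = f j"
      using range adj_in by blast
    define m where "m = (j + 9 * i) mod 10"
    have "f j = f (i + (j + 9 * i))"
      using f by (simp add: cyclic_def)
    also have "\<dots> = f (i + m)"
      using f by (simp add: cyclic_def m_def mod_add_right_eq)
    finally have eq: "w = f (i + m)"
      using j by simp
    have "m mod 10 = m"
      by (simp add: m_def)
    then have "m = 4 \<or> m = 5 \<or> m = 6"
      using w(2)[OF eq] by linarith
    then show ?thesis
      using w(1) eq by blast
  qed
  have no4: "\<not> adj (f i) (f (i + 4))" for i
  proof
    assume a: "adj (f i) (f (i + 4))"
    have idx: "i + 4 + 1 = i + 5" "i + 9 + 1 = i + 10" "i + 5 + 4 = i + 9" "i + 5 + 5 = i + 10"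
      "i + 5 + 6 = i + 1 + 10" "i + 4 + 5 = i + 9" "i + 1 + 3 = i + 4"
      by simp_all
    have s: "adj (f (i + 4)) (f (i + 5))" "adj (f i) (f (i + 1))" "adj (f (i + 9)) (f i)"
      using step[of "i + 4"] step[of i] step[of "i + 9"] per[of i] by (simp_all only: idx)
    from chord[of "i + 5"] consider
      "adj (f (i + 5)) (f (i + 9))" | "adj (f (i + 5)) (f i)" | "adj (f (i + 5)) (f (i + 1))"
      unfolding idx per by blast
    then show False
    proof cases
      case 1
      then show False
        using no_square[OF a s(1) 1 s(3)] ne[of 5 i] ne[of 5 "i + 4"] unfolding idx by force
    next
      case 2
      then show False
        using no_triangle[OF a s(1)] by blast
    next
      case 3
      then show False
        using no_square[OF a s(1) 3 adj_sym[OF s(2)]] ne[of 5 i] ne[of 3 "i + 1"] unfolding idx by force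
    qed
  qed
  have no6: "\<not> adj (f i) (f (i + 6))" for i
  proof -
    have "i + 6 + 4 = i + 10" by simp
    then show ?thesis
      using no4[of "i + 6"] per[of i] adj_sym by metis
  qed
  have "adj (f 0) (f 5)" "adj (f 1) (f 6)"
    using chord[of 0] chord[of 1] no4[of 0] no6[of 0] no4[of 1] no6[of 1] by simp_all
  moreover have "adj (f 5) (f 6)" "adj (f 0) (f 1)"
    using step[of 5] step[of 0] by simp_all
  moreover have "f 6 \<noteq> f 0" "f 5 \<noteq> f 1"
    using ne[of 6 0] ne[of 4 1] by simp_all
  ultimately show False
    using no_square adj_sym by metis
qed

end

section \<open>The Petersen graph\<close>

definition petersen_adj :: "nat \<Rightarrow> nat \<Rightarrow> bool" where
  "petersen_adj u v \<longleftrightarrow> {u, v} \<in> edges petersen"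

text \<open>Adjacency lists: vertices below 5 lie on the outer pentagon, where neighbours differ by
  \<open>1\<close> modulo 5; the others lie on the inner pentagram, where they differ by \<open>2\<close>. With the
  neighbour sets tabulated, the local conditions on the graph become finite computations.\<close>

definition petersen_nbrs :: "nat \<Rightarrow> nat set" where
  "petersen_nbrs u = (if u < 5 then {(u + 1) mod 5, (u + 4) mod 5, u + 5}
     else if u < 10 then {(u + 2) mod 5 + 5, (u + 3) mod 5 + 5, u - 5} else {})"

lemma petersen_nbrs_table:
  "petersen_nbrs 0 = {1, 4, 5}" "petersen_nbrs (Suc 0) = {2, 0, 6}" "petersen_nbrs 2 = {3, 1, 7}"
  "petersen_nbrs 3 = {4, 2, 8}" "petersen_nbrs 4 = {0, 3, 9}" "petersen_nbrs 5 = {7, 8, 0}"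
  "petersen_nbrs 6 = {8, 9, 1}" "petersen_nbrs 7 = {9, 5, 2}" "petersen_nbrs 8 = {5, 6, 3}"
  "petersen_nbrs 9 = {6, 7, 4}"
  by (simp_all add: petersen_nbrs_def flip: numeral_2_eq_2)

lemma petersen_verts: "verts petersen = {0, 1, 2, 3, 4, 5, 6, 7, 8, 9}"
  by (auto simp: petersen_def)

lemma petersen_edges: "edges petersen = {{0,1}, {0,5}, {5,7}, {1,2}, {1,6}, {6,8}, {2,3}, {2,7},
    {7,9}, {3,4}, {3,8}, {8,5}, {4,0}, {4,9}, {9,6}}"
  by (simp add: petersen_def lessThan_nat_numeral lessThan_Suc flip: numeral_2_eq_2)

lemma petersen_adj_iff: "petersen_adj u v \<longleftrightarrow> v \<in> petersen_nbrs u"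
proof (cases "u \<in> verts petersen")
  case True
  then show ?thesis
    unfolding petersen_verts
    by (elim insertE emptyE)
      (simp_all add: petersen_adj_def petersen_edges petersen_nbrs_table doubleton_eq_iff, blast+)
next
  case False
  then have "petersen_nbrs u = {}"
    by (simp add: petersen_def petersen_nbrs_def)
  moreover have "\<not> petersen_adj u v"
    using False finite_simple_graph_petersen by (auto simp: petersen_adj_def finite_simple_graph_def)
  ultimately show ?thesis
    by simp
qed

interpretation petersen: cubic_girth_five "verts petersen" petersen_adj
proof
  show "card (verts petersen) = 10"
    by (simp add: petersen_def)
  show sym: "petersen_adj v u" if "petersen_adj u v" for u v
    using that by (simp add: petersen_adj_def insert_commute)
  show mem: "v \<in> verts petersen" if "petersen_adj u v" for u v
    using that finite_simple_graph_petersen by (auto simp: petersen_adj_def finite_simple_graph_def)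
  show "card {u. petersen_adj v u} = 3" if "v \<in> verts petersen" for v
    using that unfolding petersen_adj_iff petersen_verts Collect_mem_eq
    by (elim insertE emptyE) (simp_all add: petersen_nbrs_table)
  have "\<forall>a\<in>verts petersen. \<forall>b\<in>petersen_nbrs a. \<forall>c\<in>petersen_nbrs b. a \<notin> petersen_nbrs c"
    unfolding petersen_verts by (simp add: petersen_nbrs_table)
  then show False if "petersen_adj a b" "petersen_adj b c" "petersen_adj c a" for a b c
    using that mem[OF sym[OF that(1)]] unfolding petersen_adj_iff by blast
  have "\<forall>a\<in>verts petersen. \<forall>b\<in>petersen_nbrs a. \<forall>c\<in>petersen_nbrs b. \<forall>d\<in>petersen_nbrs c.
      a \<in> petersen_nbrs d \<longrightarrow> a = c \<or> b = d"
    unfolding petersen_verts by (simp add: petersen_nbrs_table)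
  then show "a = c \<or> b = d"
    if "petersen_adj a b" "petersen_adj b c" "petersen_adj c d" "petersen_adj d a" for a b c d
    using that mem[OF sym[OF that(1)]] unfolding petersen_adj_iff by blast
qed

lemma SpecC_petersen_cyclic:
  assumes "n \<in> SpecC petersen"
  obtains f where "petersen.cyclic n f" "3 \<le> n" "n \<le> 10"
proof -
  obtain vs where vs: "3 \<le> length vs" "distinct vs" "set vs \<subseteq> verts petersen"
      "closed_path_edges vs \<subseteq> edges petersen" and n: "n = card (closed_path_edges vs)"
    using assms by (auto simp: SpecC_def cycles_def)
  have len: "n = length vs"
    using n card_closed_path_edges vs by auto
  have "petersen_adj (vs ! (i mod n)) (vs ! (Suc i mod n))" for i
  proof -
    have "{vs ! (i mod n), vs ! (Suc (i mod n) mod n)} \<in> closed_path_edges vs"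
      unfolding closed_path_edges_def len using vs(1)
      by (intro CollectI exI[of _ "i mod length vs"]) (auto intro!: mod_less_divisor)
    then show ?thesis
      using vs(4) by (auto simp: petersen_adj_def mod_Suc_eq)
  qed
  moreover have "vs ! (i mod n) = vs ! (j mod n) \<longleftrightarrow> i mod n = j mod n" for i j
  proof -
    have "i mod n < length vs" "j mod n < length vs"
      using vs(1) len by (auto intro!: mod_less_divisor)
    then show ?thesis
      using vs(2) by (simp add: nth_eq_iff_index_eq)
  qed
  ultimately have "petersen.cyclic n (\<lambda>i. vs ! (i mod n))"
    by (simp add: petersen.cyclic_def)
  moreover have "n \<le> 10"
    using card_mono[OF _ vs(3)] vs(2) petersen.card_V len
    by (simp add: distinct_card petersen_def)
  ultimately show thesis
    using that vs(1) len by blast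
qed

text \<open>For a concrete list the right-hand side unfolds by simplification.\<close>

lemma closed_path_edges_eq_set:
  "closed_path_edges vs = set (map (\<lambda>(u, v). {u, v}) (zip vs (rotate1 vs)))"
proof -
  have "set (map (\<lambda>(u, v). {u, v}) (zip vs (rotate1 vs))) =
      {{vs ! i, rotate1 vs ! i} | i. i < length vs}"
    unfolding set_map set_zip image_def by auto
  also have "\<dots> = closed_path_edges vs"
    unfolding closed_path_edges_def by (metis (no_types, lifting) nth_rotate1)
  finally show ?thesis ..
qed

lemma length_in_SpecC_petersen:
  assumes n: "length vs = n" "3 \<le> n" and vs: "distinct vs"
    "\<forall>(u, v)\<in>set (zip vs (rotate1 vs)). v \<in> petersen_nbrs u"
  shows "n \<in> SpecC petersen"
proof -
  have edges: "closed_path_edges vs \<subseteq> edges petersen"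
    using vs(2) unfolding closed_path_edges_eq_set
    by (auto simp flip: petersen_adj_iff simp: petersen_adj_def)
  have "v \<in> verts petersen" if v: "v \<in> set vs" for v
  proof -
    obtain i where "i < length vs" "v = vs ! i"
      using v by (auto simp: in_set_conv_nth)
    then have "{v, vs ! (Suc i mod length vs)} \<in> edges petersen"
      using edges by (auto simp: closed_path_edges_def)
    then show ?thesis
      using finite_simple_graph_petersen by (auto simp: finite_simple_graph_def)
  qed
  then have "closed_path_edges vs \<in> cycles petersen"
    using n vs(1) edges by (auto simp: cycles_def)
  then show ?thesis
    unfolding SpecC_def using card_closed_path_edges[of vs] n vs(1) by force
qed

lemma SpecC_petersen: "SpecC petersen = {5, 6, 8, 9}"
proof
  show "SpecC petersen \<subseteq> {5, 6, 8, 9}"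
  proof
    fix n assume "n \<in> SpecC petersen"
    then obtain f where "petersen.cyclic n f" "3 \<le> n" "n \<le> 10"
      by (rule SpecC_petersen_cyclic)
    moreover from this have "n \<noteq> 3" "n \<noteq> 4" "n \<noteq> 7" "n \<noteq> 10"
      using petersen.no_cyclic_3 petersen.no_cyclic_4 petersen.no_cyclic_7 petersen.no_cyclic_10
      by blast+
    ultimately show "n \<in> {5, 6, 8, 9}"
      by auto
  qed
  have "5 \<in> SpecC petersen"
    by (rule length_in_SpecC_petersen[of "[0, 1, 2, 3, 4]"])
      (simp_all add: petersen_nbrs_table)
  moreover have "6 \<in> SpecC petersen"
    by (rule length_in_SpecC_petersen[of "[0, 1, 2, 7, 9, 4]"])
      (simp_all add: petersen_nbrs_table)
  moreover have "8 \<in> SpecC petersen"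
    by (rule length_in_SpecC_petersen[of "[0, 1, 2, 3, 8, 6, 9, 4]"])
      (simp_all add: petersen_nbrs_table)
  moreover have "9 \<in> SpecC petersen"
    by (rule length_in_SpecC_petersen[of "[0, 1, 2, 3, 4, 9, 6, 8, 5]"])
      (simp_all add: petersen_nbrs_table)
  ultimately show "{5, 6, 8, 9} \<subseteq> SpecC petersen"
    by simp
qed

theorem mainTheorem3:
  shows "dim (span (NCV petersen)) = 4 \<and> 4 = card (SpecC petersen)"
  using dim_span_NCV[OF finite_simple_graph_petersen] by (simp add: SpecC_petersen)

end
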